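(* For every set $X$, every point of the space $2^{X_d}_f$ (regarded as a one-point subspace) is a strong deformation retract of $2^{X_d}_f$, and hence $2^{X_d}_f$ is contractible.
   Context: For a set $X$, let $X_d$ be $X$ with the discrete topology. $2^{X_d}_u$ denotes the set of all non-empty subsets of $X$ with the upper semifinite topology, i.e. the topology generated by the base of sets $B(U)=\{C\subseteq X: C\neq\emptyset,\ C\subseteq U\}$, $U\subseteq X$. $2^{X_d}_f\subset 2^{X_d}_u$ is the subspace of finite non-empty subsets of $X$, with the subspace topology. A subspace $A$ of a space $Z$ is a strong deformation retract of $Z$ if there is a continuous map $H:Z\times[0,1]\to Z$ with $H(z,0)=z$, $H(z,1)\in A$ and $H(a,t)=a$ for all $z\in Z$, $a\in A$, $t\in[0,1]$. A space is contractible if it has the homotopy type of a point. *)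

theory Defs
  imports "HOL-Analysis.Analysis"
begin

definition upper_basic :: "'a set \<Rightarrow> 'a set set" where
  "upper_basic U = {C. C \<noteq> {} \<and> C \<subseteq> U}"

text \<open>The hyperspace of non-empty subsets of \<open>X\<close>, where \<open>X\<close> carries the discrete topology:
  hence the parameter is a bare set, and \<open>U\<close> ranges over all of its subsets.\<close>

definition upper_hyperspace :: "'a set \<Rightarrow> 'a set topology" where
  "upper_hyperspace X = topology_generated_by {upper_basic U |U. U \<subseteq> X}"

definition finite_hyperspace :: "'a set \<Rightarrow> 'a set topology" where
  "finite_hyperspace X = subtopology (upper_hyperspace X) {C. finite C}"

definition strong_deformation_retract_of :: "'a set \<Rightarrow> 'a topology \<Rightarrow> bool" where
  "strong_deformation_retract_of A Z \<longleftrightarrow>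
     A \<subseteq> topspace Z \<and>
     (\<exists>H. continuous_map (prod_topology Z (top_of_set {0..1::real})) Z H \<and>
          (\<forall>z\<in>topspace Z. H (z, 0) = z \<and> H (z, 1) \<in> A) \<and>
          (\<forall>a\<in>A. \<forall>t\<in>{0..1}. H (a, t) = a))"

text \<open>Unlike \<^const>\<open>contractible_space\<close>, this excludes the empty space;
  the lemma \<open>has_homotopy_type_of_point_iff\<close> below makes the comparison precise.\<close>

definition has_homotopy_type_of_point :: "'a topology \<Rightarrow> bool" where
  "has_homotopy_type_of_point Z \<longleftrightarrow> Z homotopy_equivalent_space discrete_topology {()}"

lemma topspace_upper_hyperspace: "topspace (upper_hyperspace X) = {C. C \<noteq> {} \<and> C \<subseteq> X}"
  unfolding upper_hyperspace_def topology_generated_by_topspace upper_basic_def by blast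

lemma topspace_finite_hyperspace:
  "topspace (finite_hyperspace X) = {C. finite C \<and> C \<noteq> {} \<and> C \<subseteq> X}"
  unfolding finite_hyperspace_def topspace_subtopology topspace_upper_hyperspace by blast

lemma openin_upper_hyperspace_base:
  "openin (upper_hyperspace X) W \<longleftrightarrow> (\<exists>\<U>. \<U> \<subseteq> Pow X \<and> W = (\<Union>U\<in>\<U>. upper_basic U))"
proof
  assume "openin (upper_hyperspace X) W"
  then have "generate_topology_on {upper_basic U |U. U \<subseteq> X} W"
    by (simp add: upper_hyperspace_def openin_topology_generated_by_iff)
  then have "\<exists>U\<subseteq>X. C \<in> upper_basic U \<and> upper_basic U \<subseteq> W" if "C \<in> W" for C
    using that
  proof (induction arbitrary: C)
    case Empty
    then show ?case by simp
  next
    case (Int a b)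
    then obtain U V where "U \<subseteq> X" "C \<in> upper_basic U" "upper_basic U \<subseteq> a"
      "C \<in> upper_basic V" "upper_basic V \<subseteq> b" by (meson IntD1 IntD2)
    moreover have "upper_basic (U \<inter> V) = upper_basic U \<inter> upper_basic V"
      by (auto simp: upper_basic_def)
    ultimately show ?case by (intro exI[of _ "U \<inter> V"]) auto
  next
    case (UN K)
    then obtain k where "k \<in> K" "C \<in> k" by blast
    with UN.IH[of k C] show ?case by blast
  next
    case (Basis s)
    then show ?case by blast
  qed
  then show "\<exists>\<U>. \<U> \<subseteq> Pow X \<and> W = (\<Union>U\<in>\<U>. upper_basic U)"
    by (intro exI[of _ "{U. U \<subseteq> X \<and> upper_basic U \<subseteq> W}"]) blast
next
  assume "\<exists>\<U>. \<U> \<subseteq> Pow X \<and> W = (\<Union>U\<in>\<U>. upper_basic U)"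
  then obtain \<U> where "\<U> \<subseteq> Pow X" and W: "W = (\<Union>U\<in>\<U>. upper_basic U)" by blast
  then have "openin (upper_hyperspace X) (upper_basic U)" if "U \<in> \<U>" for U
    unfolding upper_hyperspace_def using that by (intro topology_generated_by_Basis) blast
  then show "openin (upper_hyperspace X) W"
    unfolding W by blast
qed

lemma has_homotopy_type_of_point_iff:
  "has_homotopy_type_of_point Z \<longleftrightarrow> topspace Z \<noteq> {} \<and> contractible_space Z"
proof
  assume "has_homotopy_type_of_point Z"
  then have eq: "Z homotopy_equivalent_space discrete_topology {()}"
    by (simp add: has_homotopy_type_of_point_def)
  then obtain g where "continuous_map (discrete_topology {()}) Z g"
    by (auto simp only: homotopy_equivalent_space_def)
  then have "g () \<in> topspace Z"
    using continuous_map_image_subset_topspace by fastforce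
  moreover have "contractible_space Z"
    using homotopy_equivalent_space_contractibility[OF eq] contractible_space_singleton by simp
  ultimately show "topspace Z \<noteq> {} \<and> contractible_space Z" by blast
next
  assume Z: "topspace Z \<noteq> {} \<and> contractible_space Z"
  then obtain a where a: "a \<in> topspace Z" "homotopic_with (\<lambda>x. True) Z Z id (\<lambda>x. a)"
    by (auto simp: contractible_space)
  have "homotopic_with (\<lambda>x. True) Z Z ((\<lambda>_. a) \<circ> (\<lambda>_. ())) id"
    using a(2) by (simp add: homotopic_with_sym)
  moreover have "(\<lambda>_. ()) \<circ> (\<lambda>_. a) = id"
    by (rule ext) simp
  moreover have "continuous_map Z (discrete_topology {()}) (\<lambda>_. ())"
    "continuous_map (discrete_topology {()}) Z (\<lambda>_. a)"
    using a(1) by simp_all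
  ultimately show "has_homotopy_type_of_point Z"
    unfolding has_homotopy_type_of_point_def homotopy_equivalent_space_def
    by (intro exI[of _ "\<lambda>_. ()"] exI[of _ "\<lambda>_. a"]) simp
qed

end

theory Submission
  imports Defs
begin

text \<open>
  In the upper semifinite topology the smallest neighbourhood of a set \<open>C\<close> consists of the
  non-empty subsets of \<open>C\<close>. A path may therefore sit at \<open>C\<close> up to some time, occupy a larger set
  \<open>D\<close> at that single instant, and continue at any other non-empty subset of \<open>D\<close>: both subsets
  lie in every neighbourhood of \<open>D\<close>. The union \<open>C \<union> A\<close> of two finite sets is finite and
  contains both of them, so the path that waits at \<open>C\<close>, visits \<open>C \<union> A\<close> at time \<open>1/2\<close> and rests at \<open>A\<close> afterwards
  joins \<open>C\<close> to \<open>A\<close>. It depends continuously on \<open>C\<close>, because whether it stays inside a given set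
  \<open>U\<close> is decided by \<open>C \<subseteq> U\<close> and \<open>A \<subseteq> U\<close> alone (lemma \<open>continuous_map_union_homotopy\<close>), and it
  is constant for \<open>C = A\<close>. Running all these paths at once retracts the space strongly onto
  \<open>{A}\<close>, and a space that deforms to a point is contractible.
\<close>

definition union_homotopy :: "'a set \<Rightarrow> 'a set \<times> real \<Rightarrow> 'a set" where
  "union_homotopy A = (\<lambda>(C, t). if t < 1/2 then C else if t = 1/2 then C \<union> A else A)"

lemma openin_finite_hyperspace_upper_basic:
  assumes "U \<subseteq> X"
  shows "openin (finite_hyperspace X) {C \<in> topspace (finite_hyperspace X). C \<subseteq> U}"
proof -
  have "openin (upper_hyperspace X) (upper_basic U)"
    unfolding upper_hyperspace_def using assms by (intro topology_generated_by_Basis) blast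
  then have "openin (finite_hyperspace X) (upper_basic U \<inter> {C. finite C})"
    unfolding finite_hyperspace_def by (rule openin_subtopology_Int)
  moreover have "upper_basic U \<inter> {C. finite C} = {C \<in> topspace (finite_hyperspace X). C \<subseteq> U}"
    using assms by (auto simp: topspace_finite_hyperspace upper_basic_def)
  ultimately show ?thesis by simp
qed

lemma continuous_map_into_finite_hyperspaceI:
  assumes "f \<in> topspace Y \<rightarrow> topspace (finite_hyperspace X)"
    and "\<And>U. U \<subseteq> X \<Longrightarrow> openin Y {y \<in> topspace Y. f y \<subseteq> U}"
  shows "continuous_map Y (finite_hyperspace X) f"
proof -
  have val: "finite (f y) \<and> f y \<noteq> {} \<and> f y \<subseteq> X" if "y \<in> topspace Y" for y
    using assms(1) that by (auto simp: topspace_finite_hyperspace)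
  have "continuous_map Y (upper_hyperspace X) f"
    unfolding upper_hyperspace_def
  proof (rule continuous_on_generated_topo)
    fix B assume "B \<in> {upper_basic U |U. U \<subseteq> X}"
    then obtain U where U: "U \<subseteq> X" "B = upper_basic U" by blast
    have "f -` B \<inter> topspace Y = {y \<in> topspace Y. f y \<subseteq> U}"
      using val by (auto simp: U(2) upper_basic_def)
    then show "openin Y (f -` B \<inter> topspace Y)"
      using assms(2)[OF U(1)] by simp
  next
    have "f ` topspace Y \<subseteq> upper_basic X"
      using val by (auto simp: upper_basic_def)
    then show "f ` topspace Y \<subseteq> \<Union> {upper_basic U |U. U \<subseteq> X}" by blast
  qed
  then show ?thesis
    using val by (auto simp: finite_hyperspace_def continuous_map_in_subtopology)
qed

text \<open>The path from \<open>C\<close> to \<open>A\<close> lies inside \<open>U\<close> before time \<open>1/2\<close> iff \<open>C \<subseteq> U\<close>, after it iff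
  \<open>A \<subseteq> U\<close>, and at time \<open>1/2\<close> iff both hold. In the last case it lies inside \<open>U\<close> at all times, so
  the instant \<open>1/2\<close> needs no open set of its own: the preimage of a basic open set is a union of
  three open boxes.\<close>

lemma continuous_map_union_homotopy:
  assumes A: "A \<in> topspace (finite_hyperspace X)"
  shows "continuous_map (prod_topology (finite_hyperspace X) (top_of_set {0..1}))
           (finite_hyperspace X) (union_homotopy A)"
    (is "continuous_map (prod_topology ?Z ?I) _ _")
proof (rule continuous_map_into_finite_hyperspaceI)
  show "union_homotopy A \<in> topspace (prod_topology ?Z ?I) \<rightarrow> topspace ?Z"
    using A by (auto simp: union_homotopy_def topspace_finite_hyperspace split: if_splits)
next
  fix U assume U: "U \<subseteq> X"
  let ?below = "{C \<in> topspace ?Z. C \<subseteq> U}"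
  let ?fixed = "{C \<in> topspace ?Z. A \<subseteq> U}"
  have below: "openin ?Z ?below"
    using U by (rule openin_finite_hyperspace_upper_basic)
  have "?fixed = (if A \<subseteq> U then topspace ?Z else {})"
    by auto
  then have const: "openin ?Z ?fixed" by simp
  have early: "openin ?I ({0..1} \<inter> {..<1/2})" and late: "openin ?I ({0..1} \<inter> {1/2<..})"
    by (simp_all add: openin_open_Int)
  have always: "openin ?I {0..1}" by (metis openin_subtopology_self)
  have "{p \<in> topspace (prod_topology ?Z ?I). union_homotopy A p \<subseteq> U}
      = ?below \<times> ({0..1} \<inter> {..<1/2}) \<union> ?fixed \<times> ({0..1} \<inter> {1/2<..})
        \<union> (?below \<inter> ?fixed) \<times> {0..1}"
    by (auto simp: union_homotopy_def split: if_splits)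
  moreover have "openin (prod_topology ?Z ?I) \<dots>"
    using below const early late always
    by (intro openin_Un) (simp_all only: openin_prod_Times_iff openin_Int simp_thms)
  ultimately show "openin (prod_topology ?Z ?I)
      {p \<in> topspace (prod_topology ?Z ?I). union_homotopy A p \<subseteq> U}" by simp
qed

theorem strong_deformation_retract_of_point_finite_hyperspace:
  assumes "A \<in> topspace (finite_hyperspace X)"
  shows "strong_deformation_retract_of {A} (finite_hyperspace X)"
  unfolding strong_deformation_retract_of_def
  using assms continuous_map_union_homotopy[OF assms]
  by (intro conjI exI[of _ "union_homotopy A"]) (auto simp: union_homotopy_def)

lemma strong_deformation_retract_of_point_imp_contractible_space:
  assumes "strong_deformation_retract_of {a} Z"
  shows "contractible_space Z"
proof -
  let ?I = "top_of_set {0..1::real}"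
  obtain H where H: "continuous_map (prod_topology Z ?I) Z H"
    and ends: "\<And>z. z \<in> topspace Z \<Longrightarrow> H (z, 0) = z \<and> H (z, 1) = a"
    using assms by (auto simp: strong_deformation_retract_of_def)
  \<comment> \<open>\<^const>\<open>homotopic_with\<close> takes the time parameter as the first coordinate.\<close>
  have "continuous_map (prod_topology ?I Z) Z (H \<circ> (\<lambda>(t, z). (z, t)))"
    unfolding case_prod_unfold
    using continuous_map_pairedI[OF continuous_map_snd continuous_map_fst] H
    by (rule continuous_map_compose)
  then have "homotopic_with (\<lambda>_. True) Z Z id (\<lambda>_. a)"
    using ends
    by (subst homotopic_with) (auto intro!: exI[of _ "H \<circ> (\<lambda>(t, z). (z, t))"])
  then show ?thesis
    unfolding contractible_space_def by blast
qed

theorem proposition3: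
  fixes X :: "'a set"
  shows "(\<forall>A \<in> topspace (finite_hyperspace X).
            strong_deformation_retract_of {A} (finite_hyperspace X)) \<and>
         (X \<noteq> {} \<longrightarrow> has_homotopy_type_of_point (finite_hyperspace X))"
proof (intro conjI ballI impI)
  show "strong_deformation_retract_of {A} (finite_hyperspace X)"
    if "A \<in> topspace (finite_hyperspace X)" for A
    using that by (rule strong_deformation_retract_of_point_finite_hyperspace)
next
  assume "X \<noteq> {}"
  then obtain x where "{x} \<in> topspace (finite_hyperspace X)"
    by (auto simp: topspace_finite_hyperspace)
  then show "has_homotopy_type_of_point (finite_hyperspace X)"
    using strong_deformation_retract_of_point_finite_hyperspace
      strong_deformation_retract_of_point_imp_contractible_space
    by (metis empty_iff has_homotopy_type_of_point_iff)
qed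

end
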